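(* Consider the i.i.d. mixture model $\mathbf P^{(m)}_{\pi_0,G}$ of $m$ independent $p$-values with proportion of nulls $\pi_0$ and marginal c.d.f., independent of $m$, given by $F(t)=\pi_0t+(1-\pi_0)G(t)$, where $G$ is the c.d.f. of an (alternative) distribution having a continuous decreasing density $g$ on $[0,1]$ (so that $g(0)>1$). If $\alpha,\delta$ are such that $$0<\delta<\frac1{\pi_0+(1-\pi_0)g(0)}<\alpha<1,$$ then the Simes-based closed testing bound at level $\delta$ is not $\mathrm{BH}(\alpha)$-$m$-consistent in the model $\mathbf P^{(m)}_{\pi_0,G}$, whereas the bounds $$\overline{\mathrm{FDP}}^{\mathrm{DKW}}_\alpha=\mathbf 1\{\hat k_\alpha\ge1\}\wedge\left(\alpha+\frac{m^{1/2}\sqrt{0.5\log(1/\delta)}}{1\vee\hat k_\alpha}\right)$$ and $$\overline{\mathrm{FDP}}^{\mathrm{Well}}_\alpha=\mathbf 1\{\hat k_\alpha\ge1\}\wedge\left(\alpha\,h^{-1}\!\left(\frac{2\log(\kappa/\delta)+4\log\Bigl(1+\log_2\bigl(\tfrac{m}{\alpha(1\vee\hat k_\alpha)}\bigr)\Bigr)}{\alpha(1\vee\hat k_\alpha)}\right)\right),\qquad\kappa=\pi^2/6,$$ are $\mathrm{BH}(\alpha)$-$m$-consistent in that model.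
   Context: Two-group model $\mathbf P^{(m)}_{\pi_0,G}$, $\pi_0\in(0,1)$: independently for each $i\in\{1,\dots,m\}$, hypothesis $i$ is a true null with probability $\pi_0$, in which case $p_i\sim U(0,1)$, and otherwise $p_i\sim G$; so $p_1,\dots,p_m$ are i.i.d. with c.d.f. $F$. With ordered $p$-values $p_{(1)}\le\dots\le p_{(m)}$, the procedure $\mathrm{BH}(\alpha)$ has $\hat k_\alpha=\max\{k\in\{1,\dots,m\}:mp_{(k)}/k\le\alpha\}$ rejections ($0$ if the set is empty) and rejection set $R=\{i:p_i\le p_{(\hat k_\alpha)}\}$ ($\emptyset$ if $\hat k_\alpha=0$). Simes-based closed testing bound at level $\delta$: for nonempty $I\subset\{1,\dots,m\}$, with $p_{(1:I)}\le\dots\le p_{(|I|:I)}$ the ordered $p$-values $(p_i)_{i\in I}$, the local Simes test rejects $I$ if $p_{(i:I)}\le\delta i/|I|$ for some $1\le i\le|I|$; the closed testing procedure rejects $I$ if every $J$ with $I\subset J\subset\{1,\dots,m\}$ is rejected by its local test. The bound for the number of false positives in $R$ is $\max\{|I|: I\subset R,\ I\text{ not rejected by the closed testing procedure}\}$ (with $\emptyset$ never rejected), and the FDP bound on $R$ is this number divided by $|R|\vee1$. A bound $\overline{\mathrm{FDP}}_\alpha$ for the FDP of the $\mathrm{BH}(\alpha)$ rejection set is $\mathrm{BH}(\alpha)$-$m$-consistent if for all $\epsilon>0$, $\lim_{m\to\infty}\mathbf P^{(m)}_{\pi_0,G}(\overline{\mathrm{FDP}}_\alpha-\alpha\ge\epsilon)=0$.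 The function $h(\lambda)=\lambda(\log\lambda-1)+1$, $\lambda>1$, is an increasing bijection $(1,\infty)\to(0,\infty)$ with inverse $h^{-1}$. *)

theory Defs
  imports "HOL-Probability.Probability"
begin

subsection \<open>The two-group model\<close>

text \<open>One coordinate is a pair \<open>(H, p)\<close>, where \<open>H\<close> means that the hypothesis is a true null.
  The alternative distribution is given by its law \<open>G\<close>; its distribution function is \<open>cdf G\<close>.\<close>

definition two_group_coord :: "real \<Rightarrow> real measure \<Rightarrow> (bool \<times> real) measure" where
  "two_group_coord \<pi>\<^sub>0 G =
     measure_pmf (bernoulli_pmf \<pi>\<^sub>0) \<bind>
       (\<lambda>H. distr (if H then uniform_measure lborel {0..1} else G)
               (count_space UNIV \<Otimes>\<^sub>M borel) (\<lambda>x. (H, x)))"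

definition two_group_model :: "real \<Rightarrow> real measure \<Rightarrow> nat \<Rightarrow> (nat \<Rightarrow> bool \<times> real) measure" where
  "two_group_model \<pi>\<^sub>0 G m = PiM {1..m} (\<lambda>_. two_group_coord \<pi>\<^sub>0 G)"

definition pvals :: "(nat \<Rightarrow> bool \<times> real) \<Rightarrow> nat \<Rightarrow> real" where
  "pvals \<omega> i = snd (\<omega> i)"

lemma cdf_two_group_coord:
  assumes "real_distribution G" and "\<pi>\<^sub>0 \<in> {0<..<1}" and "t \<in> {0..1}"
  shows "cdf (distr (two_group_coord \<pi>\<^sub>0 G) borel snd) t = \<pi>\<^sub>0 * t + (1 - \<pi>\<^sub>0) * cdf G t"
proof -
  interpret G: real_distribution G by fact
  let ?U = "uniform_measure lborel {0..1::real}"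
  let ?K = "count_space (UNIV :: bool set) \<Otimes>\<^sub>M (borel :: real measure)"
  let ?N = "\<lambda>H::bool. distr (if H then ?U else G) ?K (\<lambda>x. (H, x))"
  let ?S = "snd -` {..t} \<inter> space ?K"
  have U: "prob_space ?U" by (intro prob_space_uniform_measure) auto
  have mU: "(\<lambda>x. (H, x)) \<in> measurable (if H then ?U else G) ?K" for H :: bool
    by (cases H) (auto intro!: measurable_Pair simp: measurable_cong_sets[of ?U borel ?K ?K]
        measurable_cong_sets[of G borel ?K ?K])
  have pN: "prob_space (?N H)" for H
    using mU[of H] U G.prob_space_axioms
    by (intro prob_space.prob_space_distr[OF _ mU]) (cases H; simp)
  have N: "?N \<in> measurable (measure_pmf (bernoulli_pmf \<pi>\<^sub>0)) (subprob_algebra ?K)"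
    using pN by (auto simp add: space_subprob_algebra simp del: if_split intro!: prob_space_imp_subprob_space)
  have S: "?S \<in> sets ?K" by (rule measurable_sets[of snd _ borel]) auto
  have sN: "sets (two_group_coord \<pi>\<^sub>0 G) = sets ?K"
    unfolding two_group_coord_def by (rule sets_bind[of _ _ ?K]) auto
  have snd: "snd \<in> measurable (two_group_coord \<pi>\<^sub>0 G) borel"
    using sN by (simp cong: measurable_cong_sets)
  have e: "emeasure (?N H) ?S = emeasure (if H then ?U else G) {..t}" for H
  proof -
    have "(\<lambda>x. (H, x)) -` ?S \<inter> space (if H then ?U else G) = {..t}"
      by (auto simp: space_pair_measure)
    then show ?thesis using emeasure_distr[OF mU S, of H] by presburger
  qed
  have eU: "emeasure ?U {..t} = ennreal t"
  proof -
    have "{0..1} \<inter> {..t} = {0..t}" using assms(3) by auto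
    then show ?thesis using assms(3) by (simp add: emeasure_uniform_measure divide_ennreal_def)
  qed
  have "emeasure (two_group_coord \<pi>\<^sub>0 G) ?S = ennreal \<pi>\<^sub>0 * ennreal t + ennreal (1 - \<pi>\<^sub>0) * emeasure G {..t}"
    unfolding two_group_coord_def
    by (subst emeasure_bind[OF _ N S]) (use assms in \<open>simp_all add: e eU mult.commute del: emeasure_uniform_measure\<close>)
  also have "\<dots> = ennreal (\<pi>\<^sub>0 * t + (1 - \<pi>\<^sub>0) * cdf G t)"
    using assms by (simp add: cdf_def G.emeasure_eq_measure ennreal_mult ennreal_plus)
  finally have "measure (two_group_coord \<pi>\<^sub>0 G) ?S = \<pi>\<^sub>0 * t + (1 - \<pi>\<^sub>0) * cdf G t"
    using assms by (auto intro!: measure_eq_emeasure_eq_ennreal add_nonneg_nonneg mult_nonneg_nonneg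
        simp: cdf_def)
  then show ?thesis
    using snd sets_eq_imp_space_eq[OF sN] by (simp add: cdf_def measure_distr)
qed

subsection \<open>The Benjamini--Hochberg procedure\<close>

text \<open>\<open>order_stat p I k\<close> is the \<open>k\<close>-th smallest of \<open>(p i)\<close>, \<open>i \<in> I\<close>, for \<open>k\<close> from 1 to \<open>card I\<close>.\<close>

definition order_stat :: "(nat \<Rightarrow> real) \<Rightarrow> nat set \<Rightarrow> nat \<Rightarrow> real" where
  "order_stat p I k = sort (map p (sorted_list_of_set I)) ! (k - 1)"

definition bh_count :: "real \<Rightarrow> nat \<Rightarrow> (nat \<Rightarrow> real) \<Rightarrow> nat" where
  "bh_count \<alpha> m p =
     (let K = {k \<in> {1..m}. real m * order_stat p {1..m} k / real k \<le> \<alpha>}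
      in if K = {} then 0 else Max K)"

definition bh_set :: "real \<Rightarrow> nat \<Rightarrow> (nat \<Rightarrow> real) \<Rightarrow> nat set" where
  "bh_set \<alpha> m p =
     (if bh_count \<alpha> m p = 0 then {}
      else {i \<in> {1..m}. p i \<le> order_stat p {1..m} (bh_count \<alpha> m p)})"

subsection \<open>Bounds on the false discovery proportion\<close>

definition simes_rejects :: "real \<Rightarrow> (nat \<Rightarrow> real) \<Rightarrow> nat set \<Rightarrow> bool" where
  "simes_rejects \<delta> p I \<longleftrightarrow> (\<exists>i \<in> {1..card I}. order_stat p I i \<le> \<delta> * real i / real (card I))"

definition closed_rejects :: "real \<Rightarrow> nat \<Rightarrow> (nat \<Rightarrow> real) \<Rightarrow> nat set \<Rightarrow> bool" where
  "closed_rejects \<delta> m p I \<longleftrightarrow>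
     I \<noteq> {} \<and> (\<forall>J. I \<subseteq> J \<and> J \<subseteq> {1..m} \<longrightarrow> simes_rejects \<delta> p J)"

definition simes_fp_bound :: "real \<Rightarrow> nat \<Rightarrow> (nat \<Rightarrow> real) \<Rightarrow> nat set \<Rightarrow> nat" where
  "simes_fp_bound \<delta> m p R = Max {card I |I. I \<subseteq> R \<and> \<not> closed_rejects \<delta> m p I}"

definition simes_fdp_bound :: "real \<Rightarrow> real \<Rightarrow> nat \<Rightarrow> (nat \<Rightarrow> real) \<Rightarrow> real" where
  "simes_fdp_bound \<alpha> \<delta> m p =
     real (simes_fp_bound \<delta> m p (bh_set \<alpha> m p)) / real (max (card (bh_set \<alpha> m p)) 1)"

definition dkw_fdp_bound :: "real \<Rightarrow> real \<Rightarrow> nat \<Rightarrow> (nat \<Rightarrow> real) \<Rightarrow> real" where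
  "dkw_fdp_bound \<alpha> \<delta> m p =
     (let k = bh_count \<alpha> m p
      in min (of_bool (k \<ge> 1))
             (\<alpha> + sqrt (real m) * sqrt (0.5 * ln (1 / \<delta>)) / real (max 1 k)))"

definition h_fun :: "real \<Rightarrow> real" where
  "h_fun x = x * (ln x - 1) + 1"

definition h_inv :: "real \<Rightarrow> real" where
  "h_inv = inv_into {1<..} h_fun"

definition well_fdp_bound :: "real \<Rightarrow> real \<Rightarrow> nat \<Rightarrow> (nat \<Rightarrow> real) \<Rightarrow> real" where
  "well_fdp_bound \<alpha> \<delta> m p =
     (let k = bh_count \<alpha> m p; \<kappa> = pi\<^sup>2 / 6
      in min (of_bool (k \<ge> 1))
             (\<alpha> * h_inv ((2 * ln (\<kappa> / \<delta>)
                            + 4 * ln (1 + log 2 (real m / (\<alpha> * real (max 1 k)))))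
                          / (\<alpha> * real (max 1 k)))))"

subsection \<open>Consistency\<close>

text \<open>A bound is a function of the number \<open>m\<close> of hypotheses and of the \<open>p\<close>-values.\<close>

definition bh_m_consistent ::
  "real \<Rightarrow> real measure \<Rightarrow> real \<Rightarrow> (nat \<Rightarrow> (nat \<Rightarrow> real) \<Rightarrow> real) \<Rightarrow> bool" where
  "bh_m_consistent \<pi>\<^sub>0 G \<alpha> B \<longleftrightarrow>
     (\<forall>\<epsilon>>0. (\<lambda>m. measure (two_group_model \<pi>\<^sub>0 G m)
                   {\<omega> \<in> space (two_group_model \<pi>\<^sub>0 G m). B m (pvals \<omega>) - \<alpha> \<ge> \<epsilon>})
             \<longlonglongrightarrow> 0)"

end

theory Submission
  imports Defs "HOL-Real_Asymp.Real_Asymp"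
begin

text \<open>
  Let \<open>a = \<pi>\<^sub>0 + (1 - \<pi>\<^sub>0) g(0)\<close> be the slope of \<open>F\<close> at \<open>0\<close>, so that \<open>F(t) \<le> a t\<close>.

  If the Simes test does not reject the full set \<open>{1..m}\<close>, closed testing rejects nothing and the
  bound equals \<open>1\<close> as soon as BH rejects something. The Simes test rejects the full set exactly when
  \<open>BH(\<delta>)\<close> makes a rejection, and by Simes' inequality for variables with \<open>F(t) \<le> a t\<close> this has
  probability at most \<open>a \<delta> < 1\<close>. The inequality follows from the leave-one-out argument: when BH rejects
  \<open>i\<close>, replacing \<open>p\<^sub>i\<close> by \<open>0\<close> does not change the number of rejections, which then is independent
  of \<open>p\<^sub>i\<close>.

  Since \<open>a \<alpha> > 1\<close>, some \<open>t > 0\<close> has \<open>F(t) > t / \<alpha>\<close>, and Hoeffding's inequality shows that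
  \<open>BH(\<alpha>)\<close> rejects more than \<open>m t / \<alpha>\<close> hypotheses with probability tending to \<open>1\<close>. On this event
  each of the two other bounds is at most a deterministic sequence that tends to \<open>\<alpha>\<close>.
\<close>

section \<open>Counting and order statistics\<close>

definition count_le :: "('i \<Rightarrow> 'a::linorder) \<Rightarrow> 'i set \<Rightarrow> 'a \<Rightarrow> nat" where
  "count_le p I t = card {i \<in> I. p i \<le> t}"

lemma count_le_eq_sum: "finite I \<Longrightarrow> count_le p I t = (\<Sum>i\<in>I. of_bool (p i \<le> t))"
  by (simp add: count_le_def Int_def)

lemma count_le_mono: "finite I \<Longrightarrow> s \<le> t \<Longrightarrow> count_le p I s \<le> count_le p I t"
  unfolding count_le_def by (intro card_mono) auto

lemma count_le_le_card: "finite I \<Longrightarrow> count_le p I t \<le> card I"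
  unfolding count_le_def by (intro card_mono) auto

lemma count_le_fun_upd:
  assumes "p i \<le> t" "x \<le> t"
  shows "count_le (p(i := x)) I t = count_le p I t"
proof -
  have "{j \<in> I. (p(i := x)) j \<le> t} = {j \<in> I. p j \<le> t}"
    using assms by auto
  then show ?thesis
    by (simp only: count_le_def)
qed

lemma sorted_nth_le_iff_less_length_filter:
  fixes xs :: "'a::linorder list"
  assumes "sorted xs" "n < length xs"
  shows "xs ! n \<le> t \<longleftrightarrow> n < length (filter (\<lambda>x. x \<le> t) xs)"
  using assms
proof (induction xs arbitrary: n)
  case (Cons x xs)
  show ?case
  proof (cases "x \<le> t")
    case True
    then show ?thesis
      using Cons by (cases n) auto
  next
    case False
    then have greater: "\<not> y \<le> t" if "y \<in> set (x # xs)" for y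
      using Cons.prems(1) that by auto
    have "filter (\<lambda>x. x \<le> t) (x # xs) = []"
      unfolding filter_empty_conv using greater by blast
    moreover have "\<not> (x # xs) ! n \<le> t"
      using greater nth_mem[OF Cons.prems(2)] by blast
    ultimately show ?thesis
      by (simp only: list.size not_less0)
  qed
qed simp

lemma order_stat_le_iff:
  assumes "finite I" "k \<in> {1..card I}"
  shows "order_stat p I k \<le> t \<longleftrightarrow> k \<le> count_le p I t"
proof -
  let ?indices = "sorted_list_of_set I"
  have "length (filter (\<lambda>x. x \<le> t) (sort (map p ?indices))) = length (filter (\<lambda>i. p i \<le> t) ?indices)"
    by (simp add: filter_sort filter_map comp_def)
  also have "\<dots> = card (set (filter (\<lambda>i. p i \<le> t) ?indices))"
    by (rule distinct_card[symmetric]) simp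
  also have "\<dots> = count_le p I t"
    using assms by (simp add: count_le_def)
  finally show ?thesis
    using sorted_nth_le_iff_less_length_filter[of "sort (map p ?indices)" "k - 1" t] assms
    by (simp add: order_stat_def less_diff_conv) linarith
qed

section \<open>The Benjamini--Hochberg procedure\<close>

definition bh_level :: "real \<Rightarrow> nat \<Rightarrow> nat \<Rightarrow> real" where
  "bh_level \<alpha> m k = \<alpha> * real k / real m"

lemma bh_level_nonneg: "0 \<le> \<alpha> \<Longrightarrow> 0 \<le> bh_level \<alpha> m k"
  by (simp add: bh_level_def)

lemma bh_level_mono: "0 \<le> \<alpha> \<Longrightarrow> k \<le> l \<Longrightarrow> bh_level \<alpha> m k \<le> bh_level \<alpha> m l"
  unfolding bh_level_def by (intro divide_right_mono mult_left_mono) auto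

lemma bh_level_le:
  assumes "0 \<le> \<alpha>" "k \<le> m"
  shows "bh_level \<alpha> m k \<le> \<alpha>"
proof -
  have "bh_level \<alpha> m k \<le> bh_level \<alpha> m m"
    using assms by (rule bh_level_mono)
  also have "\<dots> \<le> \<alpha>"
    using assms by (simp add: bh_level_def)
  finally show ?thesis .
qed

lemma le_bh_count_iff:
  "n \<le> bh_count \<alpha> m p \<longleftrightarrow> (\<exists>k\<in>{n..m}. k \<le> count_le p {1..m} (bh_level \<alpha> m k))"
proof -
  define K where "K = {k \<in> {1..m}. k \<le> count_le p {1..m} (bh_level \<alpha> m k)}"
  have "real m * order_stat p {1..m} k / real k \<le> \<alpha> \<longleftrightarrow> k \<le> count_le p {1..m} (bh_level \<alpha> m k)"
    if "k \<in> {1..m}" for k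
    using that order_stat_le_iff[of "{1..m}" k p "bh_level \<alpha> m k"]
    by (auto simp: bh_level_def field_simps)
  then have "{k \<in> {1..m}. real m * order_stat p {1..m} k / real k \<le> \<alpha>} = K"
    unfolding K_def by blast
  then have "bh_count \<alpha> m p = (if K = {} then 0 else Max K)"
    by (simp only: bh_count_def Let_def)
  moreover have "finite K"
    by (simp add: K_def)
  ultimately have "n \<le> bh_count \<alpha> m p \<longleftrightarrow> n = 0 \<or> (\<exists>k\<in>K. n \<le> k)"
    by (auto simp: Max_ge_iff)
  also have "\<dots> \<longleftrightarrow> (\<exists>k\<in>{n..m}. k \<le> count_le p {1..m} (bh_level \<alpha> m k))"
  proof (cases "n = 0")
    case True
    then show ?thesis
      by (auto intro!: bexI[of _ "0::nat"])
  next
    case False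
    then have "k \<in> K \<and> n \<le> k \<longleftrightarrow> k \<in> {n..m} \<and> k \<le> count_le p {1..m} (bh_level \<alpha> m k)" for k
      by (auto simp: K_def)
    with False show ?thesis
      by blast
  qed
  finally show ?thesis .
qed

lemma le_bh_count: "k \<le> m \<Longrightarrow> k \<le> count_le p {1..m} (bh_level \<alpha> m k) \<Longrightarrow> k \<le> bh_count \<alpha> m p"
  unfolding le_bh_count_iff by auto

lemma
  shows bh_count_le: "bh_count \<alpha> m p \<le> m"
    and bh_count_le_count_le: "bh_count \<alpha> m p \<le> count_le p {1..m} (bh_level \<alpha> m (bh_count \<alpha> m p))"
proof -
  obtain k where "bh_count \<alpha> m p \<le> k" "k \<le> m" "k \<le> count_le p {1..m} (bh_level \<alpha> m k)"
    using le_bh_count_iff[of "bh_count \<alpha> m p" \<alpha> m p] by auto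
  moreover from this have "k \<le> bh_count \<alpha> m p"
    by (intro le_bh_count)
  ultimately show "bh_count \<alpha> m p \<le> m"
    "bh_count \<alpha> m p \<le> count_le p {1..m} (bh_level \<alpha> m (bh_count \<alpha> m p))"
    by auto
qed

lemma count_le_le_bh_count:
  assumes "t \<le> bh_level \<alpha> m (count_le p {1..m} t)"
  shows "count_le p {1..m} t \<le> bh_count \<alpha> m p"
proof (rule le_bh_count)
  show "count_le p {1..m} t \<le> m"
    using count_le_le_card[of "{1..m}" p t] by simp
  show "count_le p {1..m} t \<le> count_le p {1..m} (bh_level \<alpha> m (count_le p {1..m} t))"
    using assms by (intro count_le_mono) auto
qed

lemma count_le_bh_level_bh_count:
  assumes "0 \<le> \<alpha>"
  shows "count_le p {1..m} (bh_level \<alpha> m (bh_count \<alpha> m p)) = bh_count \<alpha> m p"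
proof (rule antisym)
  let ?r = "bh_count \<alpha> m p"
  have "bh_level \<alpha> m ?r \<le> bh_level \<alpha> m (count_le p {1..m} (bh_level \<alpha> m ?r))"
    by (intro bh_level_mono assms bh_count_le_count_le)
  then show "count_le p {1..m} (bh_level \<alpha> m ?r) \<le> ?r"
    by (rule count_le_le_bh_count)
qed (rule bh_count_le_count_le)

lemma bh_count_cong:
  assumes "\<And>i. i \<in> {1..m} \<Longrightarrow> p i = q i"
  shows "bh_count \<alpha> m p = bh_count \<alpha> m q"
proof -
  have "map p (sorted_list_of_set {1..m}) = map q (sorted_list_of_set {1..m})"
    using assms by (intro map_cong) auto
  then have "order_stat p {1..m} k = order_stat q {1..m} k" for k
    by (simp only: order_stat_def)
  then show ?thesis
    by (simp only: bh_count_def)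
qed

lemma bh_count_fun_upd:
  assumes "0 \<le> \<alpha>" "p i \<le> bh_level \<alpha> m (bh_count \<alpha> m p)" "x \<le> bh_level \<alpha> m (bh_count \<alpha> m p)"
  shows "bh_count \<alpha> m (p(i := x)) = bh_count \<alpha> m p"
proof (rule antisym)
  have count: "count_le (p(i := x)) {1..m} (bh_level \<alpha> m k) = count_le p {1..m} (bh_level \<alpha> m k)"
    if "bh_count \<alpha> m p \<le> k" for k
    using assms bh_level_mono[OF assms(1) that, of m] by (intro count_le_fun_upd) auto
  then show ge: "bh_count \<alpha> m p \<le> bh_count \<alpha> m (p(i := x))"
    using bh_count_le bh_count_le_count_le[of \<alpha> m p] by (intro le_bh_count) simp_all
  show "bh_count \<alpha> m (p(i := x)) \<le> bh_count \<alpha> m p"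
    using bh_count_le bh_count_le_count_le[of \<alpha> m "p(i := x)"] count[OF ge]
    by (intro le_bh_count) simp_all
qed

lemma bh_count_fun_upd_eq_iff:
  assumes "0 \<le> \<alpha>" "p i \<le> bh_level \<alpha> m k" "x \<le> bh_level \<alpha> m k"
  shows "bh_count \<alpha> m (p(i := x)) = k \<longleftrightarrow> bh_count \<alpha> m p = k"
  using bh_count_fun_upd[of \<alpha> p i m x] bh_count_fun_upd[of \<alpha> "p(i := x)" i m "p i"] assms by auto

lemma bh_set_eq:
  assumes "0 \<le> \<alpha>"
  shows "bh_set \<alpha> m p = {i \<in> {1..m}. p i \<le> bh_level \<alpha> m (bh_count \<alpha> m p)}"
    (is "_ = {i \<in> {1..m}. p i \<le> ?t}")
proof (cases "bh_count \<alpha> m p = 0")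
  case True
  then show ?thesis
    using count_le_bh_level_bh_count[OF assms, of p m] by (auto simp: bh_set_def count_le_def)
next
  case False
  let ?r = "bh_count \<alpha> m p" and ?s = "order_stat p {1..m} (bh_count \<alpha> m p)"
  have order_stat: "?s \<le> t \<longleftrightarrow> ?r \<le> count_le p {1..m} t" for t
    using False bh_count_le[of \<alpha> m p] by (intro order_stat_le_iff) auto
  have "{i \<in> {1..m}. p i \<le> ?s} = {i \<in> {1..m}. p i \<le> ?t}"
  proof (rule card_seteq)
    show "{i \<in> {1..m}. p i \<le> ?s} \<subseteq> {i \<in> {1..m}. p i \<le> ?t}"
      using bh_count_le_count_le[of \<alpha> m p] order_stat[of ?t] by auto
    show "card {i \<in> {1..m}. p i \<le> ?t} \<le> card {i \<in> {1..m}. p i \<le> ?s}"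
      using count_le_bh_level_bh_count[OF assms, of p m] order_stat[of ?s]
      by (simp only: count_le_def order_refl)
  qed simp
  with False show ?thesis
    by (simp only: bh_set_def if_False)
qed

lemma bh_set_subset: "bh_set \<alpha> m p \<subseteq> {1..m}"
  by (auto simp: bh_set_def)

lemma card_bh_set: "0 \<le> \<alpha> \<Longrightarrow> card (bh_set \<alpha> m p) = bh_count \<alpha> m p"
  using count_le_bh_level_bh_count[of \<alpha> p m] by (simp only: bh_set_eq count_le_def)

section \<open>The closed testing bound\<close>

lemma simes_rejects_iff:
  assumes "finite I"
  shows "simes_rejects \<delta> p I \<longleftrightarrow> (\<exists>k\<in>{1..card I}. k \<le> count_le p I (bh_level \<delta> (card I) k))"
  unfolding simes_rejects_def bh_level_def using order_stat_le_iff[OF assms] by blast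

lemma simes_rejects_atLeastAtMost_iff: "simes_rejects \<delta> p {1..m} \<longleftrightarrow> 1 \<le> bh_count \<delta> m p"
  by (simp only: simes_rejects_iff le_bh_count_iff finite_atLeastAtMost card_atLeastAtMost diff_Suc_1)

lemma le_simes_fp_bound_iff:
  assumes "finite R"
  shows "n \<le> simes_fp_bound \<delta> m p R \<longleftrightarrow> (\<exists>I\<subseteq>R. \<not> closed_rejects \<delta> m p I \<and> n \<le> card I)"
proof -
  have "{card I |I. I \<subseteq> R \<and> \<not> closed_rejects \<delta> m p I} \<subseteq> card ` Pow R"
    by auto
  then have "finite {card I |I. I \<subseteq> R \<and> \<not> closed_rejects \<delta> m p I}"
    by (rule finite_subset) (simp add: assms)
  moreover have "card ({} :: nat set) \<in> {card I |I. I \<subseteq> R \<and> \<not> closed_rejects \<delta> m p I}"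
    unfolding closed_rejects_def by blast
  ultimately show ?thesis
    unfolding simes_fp_bound_def by (subst Max_ge_iff) auto
qed

lemma one_le_simes_fdp_bound:
  assumes "0 \<le> \<alpha>" "1 \<le> bh_count \<alpha> m p" "bh_count \<delta> m p = 0"
  shows "1 \<le> simes_fdp_bound \<alpha> \<delta> m p"
proof -
  let ?R = "bh_set \<alpha> m p"
  have "\<not> closed_rejects \<delta> m p ?R"
    using assms(3) bh_set_subset[of \<alpha> m p] simes_rejects_atLeastAtMost_iff[of \<delta> p m]
    unfolding closed_rejects_def by auto
  then have "card ?R \<le> simes_fp_bound \<delta> m p ?R"
    using finite_subset[OF bh_set_subset] by (subst le_simes_fp_bound_iff) auto
  moreover have "1 \<le> card ?R"
    using assms(1,2) by (simp add: card_bh_set)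
  ultimately show ?thesis
    unfolding simes_fdp_bound_def by (simp add: le_divide_eq)
qed

section \<open>Measurability\<close>

lemma measurable_natI:
  fixes f :: "'a \<Rightarrow> nat"
  assumes [measurable]: "\<And>n. Measurable.pred M (\<lambda>\<omega>. n \<le> f \<omega>)"
  shows "f \<in> measurable M (count_space UNIV)"
proof -
  have "Measurable.pred M (\<lambda>\<omega>. n \<le> f \<omega> \<and> \<not> Suc n \<le> f \<omega>)" for n
    by measurable
  moreover have "f -` {n} \<inter> space M = {\<omega> \<in> space M. n \<le> f \<omega> \<and> \<not> Suc n \<le> f \<omega>}" for n
    by auto
  ultimately show ?thesis
    by (auto simp: measurable_count_space_eq2_countable pred_def)
qed

lemma measurable_count_le:
  fixes p :: "'a \<Rightarrow> 'i \<Rightarrow> real"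
  assumes "finite I" and [measurable]: "\<And>i. i \<in> I \<Longrightarrow> (\<lambda>\<omega>. p \<omega> i) \<in> borel_measurable M"
    "f \<in> borel_measurable M"
  shows "(\<lambda>\<omega>. count_le (p \<omega>) I (f \<omega>)) \<in> measurable M (count_space UNIV)"
  by (simp add: count_le_eq_sum[OF assms(1)] of_bool_def)

context
  fixes p :: "'a \<Rightarrow> nat \<Rightarrow> real" and M :: "'a measure" and m :: nat
  assumes p [measurable]: "\<And>i. i \<in> {1..m} \<Longrightarrow> (\<lambda>\<omega>. p \<omega> i) \<in> borel_measurable M"
begin

lemma measurable_bh_count: "(\<lambda>\<omega>. bh_count \<alpha> m (p \<omega>)) \<in> measurable M (count_space UNIV)"
proof (rule measurable_natI)
  have [measurable]: "(\<lambda>\<omega>. count_le (p \<omega>) {1..m} t) \<in> measurable M (count_space UNIV)" for t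
    by (intro measurable_count_le p) auto
  show "Measurable.pred M (\<lambda>\<omega>. n \<le> bh_count \<alpha> m (p \<omega>))" for n
    unfolding le_bh_count_iff by measurable
qed

lemma pred_in_bh_set:
  assumes "0 \<le> \<alpha>"
  shows "Measurable.pred M (\<lambda>\<omega>. i \<in> bh_set \<alpha> m (p \<omega>))"
proof (cases "i \<in> {1..m}")
  case [measurable]: True
  note [measurable] = measurable_bh_count
  have "Measurable.pred M (\<lambda>\<omega>. p \<omega> i \<le> bh_level \<alpha> m (bh_count \<alpha> m (p \<omega>)))"
    unfolding bh_level_def by measurable
  with True show ?thesis
    by (simp only: bh_set_eq[OF assms] mem_Collect_eq simp_thms)
next
  case False
  then have "i \<notin> bh_set \<alpha> m (p \<omega>)" for \<omega>
    using bh_set_subset by blast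
  then show ?thesis
    by simp
qed

lemma pred_simes_rejects:
  assumes J: "J \<subseteq> {1..m}"
  shows "Measurable.pred M (\<lambda>\<omega>. simes_rejects \<delta> (p \<omega>) J)"
proof -
  have finite: "finite J"
    using J by (rule finite_subset) simp
  have [measurable]: "(\<lambda>\<omega>. count_le (p \<omega>) J t) \<in> measurable M (count_space UNIV)" for t
    using J by (intro measurable_count_le p finite) auto
  show ?thesis
    unfolding simes_rejects_iff[OF finite] by measurable
qed

lemma pred_closed_rejects: "Measurable.pred M (\<lambda>\<omega>. closed_rejects \<delta> m (p \<omega>) I)"
proof -
  let ?\<J> = "{J. I \<subseteq> J \<and> J \<subseteq> {1..m}}"
  have [measurable]: "Measurable.pred M (\<lambda>\<omega>. simes_rejects \<delta> (p \<omega>) J)" if "J \<in> ?\<J>" for J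
    using that by (intro pred_simes_rejects) simp
  have [measurable]: "countable ?\<J>"
    by (rule countable_finite, rule finite_subset[of _ "Pow {1..m}"]) auto
  have "closed_rejects \<delta> m (p \<omega>) I \<longleftrightarrow> I \<noteq> {} \<and> (\<forall>J \<in> ?\<J>. simes_rejects \<delta> (p \<omega>) J)" for \<omega>
    by (auto simp: closed_rejects_def)
  then show ?thesis
    by (simp only:) measurable
qed

lemma measurable_simes_fdp_bound:
  assumes "0 \<le> \<alpha>"
  shows "(\<lambda>\<omega>. simes_fdp_bound \<alpha> \<delta> m (p \<omega>)) \<in> borel_measurable M"
proof -
  note [measurable] = pred_closed_rejects pred_in_bh_set[OF assms] measurable_bh_count
  define fp_bound where "fp_bound \<omega> = simes_fp_bound \<delta> m (p \<omega>) (bh_set \<alpha> m (p \<omega>))" for \<omega>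
  have [measurable]: "fp_bound \<in> measurable M (count_space UNIV)"
  proof (rule measurable_natI)
    fix n
    have "n \<le> fp_bound \<omega> \<longleftrightarrow>
        (\<exists>I\<in>Pow {1..m}. (\<forall>i\<in>I. i \<in> bh_set \<alpha> m (p \<omega>)) \<and> \<not> closed_rejects \<delta> m (p \<omega>) I \<and> n \<le> card I)" for \<omega>
      using bh_set_subset[of \<alpha> m "p \<omega>"] finite_subset[OF bh_set_subset[of \<alpha> m "p \<omega>"]]
      unfolding fp_bound_def by (subst le_simes_fp_bound_iff) auto
    moreover have [measurable]: "countable (Pow {1..m})"
      by (simp add: countable_finite)
    ultimately show "Measurable.pred M (\<lambda>\<omega>. n \<le> fp_bound \<omega>)"
      by (simp only:) measurable
  qed
  show ?thesis
    unfolding simes_fdp_bound_def card_bh_set[OF assms] fp_bound_def[symmetric] by measurable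
qed

end

lemma measurable_bh_count_fun_upd:
  assumes "\<And>j. j \<in> {1..m} - {i} \<Longrightarrow> (\<lambda>\<omega>. p \<omega> j) \<in> borel_measurable M"
  shows "(\<lambda>\<omega>. bh_count \<alpha> m ((p \<omega>)(i := x))) \<in> measurable M (count_space UNIV)"
proof (rule measurable_bh_count)
  fix j assume "j \<in> {1..m}"
  then show "(\<lambda>\<omega>. ((p \<omega>)(i := x)) j) \<in> borel_measurable M"
    using assms by (cases "j = i") simp_all
qed

section \<open>Independent p-values\<close>

lemma (in prob_space) sum_prob_eq:
  assumes "finite K" and X: "X \<in> measurable M (count_space UNIV)"
  shows "(\<Sum>k\<in>K. \<P>(\<omega> in M. X \<omega> = k)) = \<P>(\<omega> in M. X \<omega> \<in> K)"
proof -
  have "{\<omega> \<in> space M. P (X \<omega>)} \<in> events" for P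
    using measurable_compose[OF X measurable_count_space[of P UNIV]] by (simp only: pred_def)
  then show ?thesis
    using assms(1) by (intro prob_sum[symmetric]) auto
qed

locale indep_pvalues = prob_space M for M :: "'a measure" +
  fixes p :: "'a \<Rightarrow> nat \<Rightarrow> real" and m :: nat
  assumes indep_vars_pvalues: "indep_vars (\<lambda>_. borel) (\<lambda>i \<omega>. p \<omega> i) {1..m}"
begin

lemma measurable_pvalue [measurable]: "i \<in> {1..m} \<Longrightarrow> (\<lambda>\<omega>. p \<omega> i) \<in> borel_measurable M"
  using indep_vars_pvalues by (simp add: indep_vars_def)

lemma measurable_bh_count_pvalues [measurable]:
  "(\<lambda>\<omega>. bh_count \<alpha> m (p \<omega>)) \<in> measurable M (count_space UNIV)"
  by (rule measurable_bh_count[OF measurable_pvalue])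

lemma measurable_bh_count_leave_one_out [measurable]:
  "(\<lambda>\<omega>. bh_count \<alpha> m ((p \<omega>)(i := x))) \<in> measurable M (count_space UNIV)"
  by (intro measurable_bh_count_fun_upd measurable_pvalue) simp

lemma measurable_count_le_pvalues [measurable]:
  "(\<lambda>\<omega>. count_le (p \<omega>) {1..m} t) \<in> measurable M (count_space UNIV)"
  by (intro measurable_count_le measurable_pvalue) simp_all

(* indep_var relates random variables of one type, hence the coercion of the count. *)
lemma indep_var_bh_count_leave_one_out:
  assumes i: "i \<in> {1..m}"
  shows "indep_var borel (\<lambda>\<omega>. p \<omega> i) borel (\<lambda>\<omega>. real (bh_count \<alpha> m ((p \<omega>)(i := x))))"
proof -
  let ?J = "{1..m} - {i}"
  have [measurable]: "(\<lambda>f. bh_count \<alpha> m (f(i := x))) \<in> measurable (PiM ?J (\<lambda>_. borel)) (count_space UNIV)"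
    by (rule measurable_bh_count_fun_upd) measurable
  have "indep_var borel ((\<lambda>f. f i) \<circ> (\<lambda>\<omega>. restrict (p \<omega>) {i}))
      borel ((\<lambda>f. real (bh_count \<alpha> m (f(i := x)))) \<circ> (\<lambda>\<omega>. restrict (p \<omega>) ?J))"
  proof (rule indep_var_compose[OF indep_var_restrict[OF indep_vars_pvalues]])
    show "(\<lambda>f. f i) \<in> borel_measurable (PiM {i} (\<lambda>_. borel))"
      by simp
    show "(\<lambda>f. real (bh_count \<alpha> m (f(i := x)))) \<in> borel_measurable (PiM ?J (\<lambda>_. borel))"
      by measurable
  qed (use i in auto)
  also have "(\<lambda>f. f i) \<circ> (\<lambda>\<omega>. restrict (p \<omega>) {i}) = (\<lambda>\<omega>. p \<omega> i)"
    by auto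
  also have "(\<lambda>f. real (bh_count \<alpha> m (f(i := x)))) \<circ> (\<lambda>\<omega>. restrict (p \<omega>) ?J) =
      (\<lambda>\<omega>. real (bh_count \<alpha> m ((p \<omega>)(i := x))))"
    unfolding comp_def by (intro ext arg_cong[where f = real] bh_count_cong) auto
  finally show ?thesis .
qed

lemma mult_prob_bh_count_eq_sum:
  assumes "0 \<le> \<alpha>"
  shows "real k * \<P>(\<omega> in M. bh_count \<alpha> m (p \<omega>) = k) =
    (\<Sum>i\<in>{1..m}. \<P>(\<omega> in M. p \<omega> i \<le> bh_level \<alpha> m k \<and> bh_count \<alpha> m (p \<omega>) = k))"
proof -
  let ?A = "{\<omega> \<in> space M. bh_count \<alpha> m (p \<omega>) = k}"
  let ?B = "\<lambda>i. {\<omega> \<in> space M. p \<omega> i \<le> bh_level \<alpha> m k \<and> bh_count \<alpha> m (p \<omega>) = k}"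
  have event: "?B i \<in> events" if [measurable]: "i \<in> {1..m}" for i
    by measurable
  have "real k * indicator ?A \<omega> = (\<Sum>i\<in>{1..m}. indicator (?B i) \<omega>)" if "\<omega> \<in> space M" for \<omega>
  proof (cases "bh_count \<alpha> m (p \<omega>) = k")
    case True
    then have "(\<Sum>i\<in>{1..m}. indicator (?B i) \<omega>) = real (count_le (p \<omega>) {1..m} (bh_level \<alpha> m k))"
      using that by (simp add: count_le_eq_sum indicator_def)
    also have "\<dots> = real k"
      using count_le_bh_level_bh_count[OF assms, of "p \<omega>" m] True by simp
    finally show ?thesis
      using True that by simp
  qed simp
  then have "(\<integral>\<omega>. real k * indicator ?A \<omega> \<partial>M) = (\<integral>\<omega>. (\<Sum>i\<in>{1..m}. indicator (?B i) \<omega>) \<partial>M)"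
    by (rule Bochner_Integration.integral_cong[OF refl])
  also have "\<dots> = (\<Sum>i\<in>{1..m}. \<integral>\<omega>. indicator (?B i) \<omega> \<partial>M)"
    by (intro Bochner_Integration.integral_sum integrable_real_indicator event)
      (simp_all add: less_top[symmetric])
  finally show ?thesis
    using event by simp
qed

lemma prob_le_bh_level_and_bh_count_eq:
  assumes "0 \<le> \<alpha>" and i: "i \<in> {1..m}"
  shows "\<P>(\<omega> in M. p \<omega> i \<le> bh_level \<alpha> m k \<and> bh_count \<alpha> m (p \<omega>) = k) =
    \<P>(\<omega> in M. p \<omega> i \<le> bh_level \<alpha> m k) * \<P>(\<omega> in M. bh_count \<alpha> m ((p \<omega>)(i := 0)) = k)"
proof -
  let ?t = "bh_level \<alpha> m k" and ?R = "\<lambda>\<omega>. real (bh_count \<alpha> m ((p \<omega>)(i := 0)))"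
  have "p \<omega> i \<le> ?t \<and> bh_count \<alpha> m (p \<omega>) = k \<longleftrightarrow> p \<omega> i \<le> ?t \<and> ?R \<omega> = real k" for \<omega>
    using bh_count_fun_upd_eq_iff[of \<alpha> "p \<omega>" i m k 0] bh_level_nonneg[OF assms(1), of m k] assms(1)
    by auto
  then have "\<P>(\<omega> in M. p \<omega> i \<le> ?t \<and> bh_count \<alpha> m (p \<omega>) = k) =
      \<P>(\<omega> in M. p \<omega> i \<le> ?t \<and> ?R \<omega> = real k)"
    by (simp only:)
  also have "\<dots> = prob ((\<lambda>\<omega>. (p \<omega> i, ?R \<omega>)) -` ({..?t} \<times> {real k}) \<inter> space M)"
    by (intro arg_cong[where f = prob]) auto
  also have "\<dots> = prob ((\<lambda>\<omega>. p \<omega> i) -` {..?t} \<inter> space M) * prob (?R -` {real k} \<inter> space M)"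
    by (rule indep_varD[OF indep_var_bh_count_leave_one_out[OF i]]) simp_all
  also have "\<dots> = \<P>(\<omega> in M. p \<omega> i \<le> ?t) * \<P>(\<omega> in M. bh_count \<alpha> m ((p \<omega>)(i := 0)) = k)"
    by (intro arg_cong2[where f = "(*)"] arg_cong[where f = prob]) auto
  finally show ?thesis .
qed

lemma prob_bh_count_eq_le_sum:
  assumes "0 \<le> \<delta>" "k \<in> {1..m}"
    and F: "\<And>i t. i \<in> {1..m} \<Longrightarrow> t \<in> {0..\<delta>} \<Longrightarrow> \<P>(\<omega> in M. p \<omega> i \<le> t) \<le> a * t"
  shows "\<P>(\<omega> in M. bh_count \<delta> m (p \<omega>) = k) \<le>
    (\<Sum>i\<in>{1..m}. a * \<delta> / m * \<P>(\<omega> in M. bh_count \<delta> m ((p \<omega>)(i := 0)) = k))"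
proof -
  let ?t = "bh_level \<delta> m k"
  have t: "?t \<in> {0..\<delta>}"
    using assms by (simp add: bh_level_nonneg bh_level_le)
  have "real k * \<P>(\<omega> in M. bh_count \<delta> m (p \<omega>) = k) =
      (\<Sum>i\<in>{1..m}. \<P>(\<omega> in M. p \<omega> i \<le> ?t) * \<P>(\<omega> in M. bh_count \<delta> m ((p \<omega>)(i := 0)) = k))"
    unfolding mult_prob_bh_count_eq_sum[OF assms(1)]
    by (intro sum.cong refl prob_le_bh_level_and_bh_count_eq[OF assms(1)])
  also have "\<dots> \<le> (\<Sum>i\<in>{1..m}. a * ?t * \<P>(\<omega> in M. bh_count \<delta> m ((p \<omega>)(i := 0)) = k))"
    by (intro sum_mono mult_right_mono F t) simp_all
  also have "\<dots> = real k * (\<Sum>i\<in>{1..m}. a * \<delta> / m * \<P>(\<omega> in M. bh_count \<delta> m ((p \<omega>)(i := 0)) = k))"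
    by (simp add: bh_level_def sum_distrib_left mult_ac)
  finally show ?thesis
    using assms(2) by simp
qed

lemma simes_inequality:
  assumes "0 \<le> \<delta>" "0 \<le> a"
    and F: "\<And>i t. i \<in> {1..m} \<Longrightarrow> t \<in> {0..\<delta>} \<Longrightarrow> \<P>(\<omega> in M. p \<omega> i \<le> t) \<le> a * t"
  shows "\<P>(\<omega> in M. 1 \<le> bh_count \<delta> m (p \<omega>)) \<le> a * \<delta>"
proof -
  have "\<P>(\<omega> in M. 1 \<le> bh_count \<delta> m (p \<omega>)) = \<P>(\<omega> in M. bh_count \<delta> m (p \<omega>) \<in> {1..m})"
    using bh_count_le by (intro arg_cong[where f = prob]) auto
  also have "\<dots> = (\<Sum>k\<in>{1..m}. \<P>(\<omega> in M. bh_count \<delta> m (p \<omega>) = k))"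
    by (intro sum_prob_eq[symmetric]) measurable
  also have "\<dots> \<le> (\<Sum>k\<in>{1..m}. \<Sum>i\<in>{1..m}. a * \<delta> / m * \<P>(\<omega> in M. bh_count \<delta> m ((p \<omega>)(i := 0)) = k))"
    using assms by (intro sum_mono prob_bh_count_eq_le_sum)
  also have "\<dots> = (\<Sum>i\<in>{1..m}. a * \<delta> / m * (\<Sum>k\<in>{1..m}. \<P>(\<omega> in M. bh_count \<delta> m ((p \<omega>)(i := 0)) = k)))"
    by (subst sum.swap) (simp only: sum_distrib_left)
  also have "\<dots> \<le> (\<Sum>i\<in>{1..m}. a * \<delta> / m * 1)"
  proof (intro sum_mono mult_left_mono)
    fix i
    show "(\<Sum>k\<in>{1..m}. \<P>(\<omega> in M. bh_count \<delta> m ((p \<omega>)(i := 0)) = k)) \<le> 1"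
      unfolding sum_prob_eq[OF finite_atLeastAtMost measurable_bh_count_leave_one_out] by simp
  qed (use assms in simp)
  also have "\<dots> \<le> a * \<delta>"
    using assms by simp
  finally show ?thesis .
qed

lemma prob_one_le_simes_fdp_bound_ge:
  assumes "0 \<le> \<alpha>"
  shows "1 - \<P>(\<omega> in M. 1 \<le> bh_count \<delta> m (p \<omega>)) - \<P>(\<omega> in M. bh_count \<alpha> m (p \<omega>) = 0)
    \<le> \<P>(\<omega> in M. 1 \<le> simes_fdp_bound \<alpha> \<delta> m (p \<omega>))"
proof -
  let ?E = "{\<omega> \<in> space M. 1 \<le> bh_count \<delta> m (p \<omega>)}"
  let ?K = "{\<omega> \<in> space M. bh_count \<alpha> m (p \<omega>) = 0}"
  let ?B = "{\<omega> \<in> space M. 1 \<le> simes_fdp_bound \<alpha> \<delta> m (p \<omega>)}"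
  have [measurable]: "(\<lambda>\<omega>. simes_fdp_bound \<alpha> \<delta> m (p \<omega>)) \<in> borel_measurable M"
    using assms by (intro measurable_simes_fdp_bound measurable_pvalue)
  have "\<omega> \<in> ?E \<union> ?K \<union> ?B" if "\<omega> \<in> space M" for \<omega>
    using that one_le_simes_fdp_bound[OF assms, of m "p \<omega>" \<delta>] by force
  then have "prob (space M) \<le> prob (?E \<union> ?K \<union> ?B)"
    by (intro finite_measure_mono subsetI) measurable
  also have "\<dots> \<le> prob ?E + prob ?K + prob ?B"
    by (intro order_trans[OF measure_Un_le] add_right_mono measure_Un_le) measurable
  finally show ?thesis
    by (simp add: prob_space)
qed

lemma prob_count_le_le:
  fixes q t \<eta> :: real
  assumes "0 \<le> \<eta>" and q: "\<And>i. i \<in> {1..m} \<Longrightarrow> q \<le> \<P>(\<omega> in M. p \<omega> i \<le> t)"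
  shows "\<P>(\<omega> in M. real (count_le (p \<omega>) {1..m} t) \<le> m * (q - \<eta>)) \<le> exp (- 2 * \<eta>\<^sup>2 * m)"
proof (cases "m = 0")
  case False
  let ?X = "\<lambda>i \<omega>. indicator {..t} (p \<omega> i) :: real"
  define \<mu> where "\<mu> = (\<Sum>i\<in>{1..m}. expectation (?X i))"
  interpret Hoeffding_ineq M "{1..m}" ?X "\<lambda>_. 0" "\<lambda>_. 1" \<mu>
  proof unfold_locales
    show "indep_vars (\<lambda>_. borel) ?X {1..m}"
      by (rule indep_vars_compose2[OF indep_vars_pvalues]) simp
  qed (auto simp: \<mu>_def indicator_def)
  have "expectation (?X i) = \<P>(\<omega> in M. p \<omega> i \<le> t)" if [measurable]: "i \<in> {1..m}" for i
  proof -
    have "expectation (?X i) = expectation (indicator {\<omega> \<in> space M. p \<omega> i \<le> t})"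
      by (intro Bochner_Integration.integral_cong) (auto simp: indicator_def)
    then show ?thesis
      by simp
  qed
  then have "real m * q \<le> \<mu>"
    using q sum_mono[of "{1..m}" "\<lambda>_. q" "\<lambda>i. expectation (?X i)"] by (simp add: \<mu>_def)
  moreover have "real (count_le (p \<omega>) {1..m} t) = (\<Sum>i\<in>{1..m}. ?X i \<omega>)" for \<omega>
    by (simp add: count_le_eq_sum indicator_def)
  ultimately have "\<P>(\<omega> in M. real (count_le (p \<omega>) {1..m} t) \<le> m * (q - \<eta>)) \<le>
      \<P>(\<omega> in M. (\<Sum>i\<in>{1..m}. ?X i \<omega>) \<le> \<mu> - m * \<eta>)"
    by (intro finite_measure_mono) (auto simp: right_diff_distrib)
  also have "\<dots> \<le> exp (- 2 * (real m * \<eta>)\<^sup>2 / (\<Sum>i\<in>{1..m}. (1 - 0)\<^sup>2))"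
    using assms(1) False by (intro Hoeffding_ineq_le) auto
  also have "- 2 * (real m * \<eta>)\<^sup>2 / (\<Sum>i\<in>{1..m}. (1 - 0)\<^sup>2) = - 2 * \<eta>\<^sup>2 * m"
    using False by (simp add: power2_eq_square)
  finally show ?thesis .
qed simp

lemma prob_bh_count_le:
  fixes q t :: real
  assumes "0 < \<alpha>" "t / \<alpha> \<le> q" and q: "\<And>i. i \<in> {1..m} \<Longrightarrow> q \<le> \<P>(\<omega> in M. p \<omega> i \<le> t)"
  shows "\<P>(\<omega> in M. real (bh_count \<alpha> m (p \<omega>)) \<le> m * (t / \<alpha>)) \<le> exp (- 2 * (q - t / \<alpha>)\<^sup>2 * m)"
proof (cases "m = 0")
  case False
  let ?N = "\<lambda>\<omega>. count_le (p \<omega>) {1..m} t"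
  have "real (?N \<omega>) \<le> m * (t / \<alpha>)" if "real (bh_count \<alpha> m (p \<omega>)) \<le> m * (t / \<alpha>)" for \<omega>
  proof (rule ccontr)
    assume less: "\<not> ?thesis"
    then have "t \<le> bh_level \<alpha> m (?N \<omega>)"
      using False assms(1) by (simp add: bh_level_def field_simps)
    then have "?N \<omega> \<le> bh_count \<alpha> m (p \<omega>)"
      by (rule count_le_le_bh_count)
    with less that show False
      by linarith
  qed
  then have "\<P>(\<omega> in M. real (bh_count \<alpha> m (p \<omega>)) \<le> m * (t / \<alpha>)) \<le>
      \<P>(\<omega> in M. real (?N \<omega>) \<le> m * (q - (q - t / \<alpha>)))"
  proof (intro finite_measure_mono)
    show "{\<omega> \<in> space M. real (?N \<omega>) \<le> m * (q - (q - t / \<alpha>))} \<in> events"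
      by measurable
  qed auto
  also have "\<dots> \<le> exp (- 2 * (q - t / \<alpha>)\<^sup>2 * m)"
    using assms(2) by (intro prob_count_le_le q) auto
  finally show ?thesis .
qed simp

end

section \<open>The DKW and Wellner bounds under linearly many rejections\<close>

lemma dkw_fdp_bound_le:
  assumes "0 < \<delta>" "\<delta> \<le> 1" "0 < c" "0 < m" "real m * c \<le> real (bh_count \<alpha> m p)"
  shows "dkw_fdp_bound \<alpha> \<delta> m p \<le> \<alpha> + sqrt (0.5 * ln (1 / \<delta>)) / (sqrt (real m) * c)"
proof -
  define K where "K = sqrt (0.5 * ln (1 / \<delta>))"
  let ?k = "bh_count \<alpha> m p"
  have "K \<ge> 0"
    using assms by (simp add: K_def)
  have "dkw_fdp_bound \<alpha> \<delta> m p \<le> \<alpha> + sqrt (real m) * K / real (max 1 ?k)"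
    unfolding dkw_fdp_bound_def Let_def K_def by (rule min.cobounded2)
  also have "sqrt (real m) * K / real (max 1 ?k) \<le> sqrt (real m) * K / (real m * c)"
    using assms \<open>K \<ge> 0\<close> by (intro divide_left_mono) auto
  also have "\<dots> = K / (sqrt (real m) * c)"
    using assms(4) by (simp add: divide_simps)
  finally show ?thesis
    by (simp add: K_def)
qed

lemma strict_mono_on_h_fun: "strict_mono_on {1..} h_fun"
proof (rule strict_mono_onI)
  fix x y :: real assume xy: "x \<in> {1..}" "y \<in> {1..}" "x < y"
  have "\<exists>z. x < z \<and> z < y \<and> h_fun y - h_fun x = (y - x) * ln z"
  proof (rule MVT2[OF xy(3)])
    fix z assume "x \<le> z" "z \<le> y"
    then show "DERIV h_fun z :> ln z"
      unfolding h_fun_def using xy by (auto intro!: derivative_eq_intros)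
  qed
  then obtain z where z: "x < z" "h_fun y - h_fun x = (y - x) * ln z"
    by blast
  then have "(y - x) * ln z > 0"
    using xy by (intro mult_pos_pos) auto
  with z show "h_fun x < h_fun y"
    by linarith
qed

lemma h_fun_1: "h_fun 1 = 0"
  by (simp add: h_fun_def)

lemma bij_betw_h_fun: "bij_betw h_fun {1<..} {0<..}"
proof (rule bij_betw_imageI)
  show "inj_on h_fun {1<..}"
    using strict_mono_on_imp_inj_on[OF strict_mono_on_h_fun] by (rule inj_on_subset) auto
  show "h_fun ` {1<..} = {0<..}"
  proof (intro equalityI subsetI)
    fix y assume "y \<in> h_fun ` {1<..}"
    then show "y \<in> {0<..}"
      using strict_mono_onD[OF strict_mono_on_h_fun, of 1] by (auto simp: h_fun_1)
  next
    fix y :: real assume y: "y \<in> {0<..}"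
    define u where "u = max (exp 2) y"
    have u: "exp 2 \<le> u" "0 < u" "y \<le> u"
      by (simp_all add: u_def less_max_iff_disj)
    then have "2 \<le> ln u"
      by (simp add: ln_ge_iff)
    then have "u * 1 \<le> u * (ln u - 1)"
      using u(2) by (intro mult_left_mono) auto
    then have "y \<le> h_fun u"
      using u(3) by (simp add: h_fun_def)
    moreover have "1 \<le> u"
      using u(1) one_le_exp_iff[of "2::real"] by linarith
    moreover have "continuous_on {1..u} h_fun"
      unfolding h_fun_def by (intro continuous_intros) auto
    ultimately obtain x where x: "1 \<le> x" "h_fun x = y"
      using IVT'[of h_fun 1 y u] y by (auto simp: h_fun_1)
    then have "x \<noteq> 1"
      using y by (auto simp: h_fun_1)
    with x show "y \<in> h_fun ` {1<..}"
      by force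
  qed
qed

lemma
  assumes "0 < y"
  shows h_inv_gt_1: "1 < h_inv y" and h_fun_h_inv: "h_fun (h_inv y) = y"
proof -
  have y: "y \<in> h_fun ` {1<..}"
    using assms by (simp add: bij_betw_imp_surj_on[OF bij_betw_h_fun])
  show "1 < h_inv y"
    using inv_into_into[OF y] by (simp add: h_inv_def)
  show "h_fun (h_inv y) = y"
    using f_inv_into_f[OF y] by (simp add: h_inv_def)
qed

lemma h_inv_less_iff:
  assumes "0 < y" "1 \<le> u"
  shows "h_inv y < u \<longleftrightarrow> y < h_fun u"
  using strict_mono_on_less[OF strict_mono_on_h_fun, of "h_inv y" u] h_inv_gt_1[OF assms(1)] assms
  by (simp add: h_fun_h_inv)

lemma h_inv_mono:
  assumes "0 < x" "x \<le> y"
  shows "h_inv x \<le> h_inv y"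
  using h_inv_less_iff[of y "h_inv x"] h_inv_gt_1[OF assms(1)] assms by (auto simp: h_fun_h_inv)

lemma tendsto_h_inv_at_right_0: "(h_inv \<longlongrightarrow> 1) (at_right 0)"
proof (rule order_tendstoI)
  fix u :: real assume "1 < u"
  then have "0 < h_fun u"
    using strict_mono_onD[OF strict_mono_on_h_fun, of 1 u] by (simp add: h_fun_1)
  then have "\<forall>\<^sub>F y in at_right 0. y < h_fun u \<and> 0 < y"
    by (intro eventually_conj eventually_at_right_less)
       (auto simp: eventually_at_right_field)
  then show "\<forall>\<^sub>F y in at_right 0. h_inv y < u"
    by eventually_elim (use \<open>1 < u\<close> in \<open>simp add: h_inv_less_iff\<close>)
next
  fix u :: real assume "u < 1"
  show "\<forall>\<^sub>F y in at_right 0. u < h_inv y"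
    using eventually_at_right_less[of 0]
    by eventually_elim (use \<open>u < 1\<close> h_inv_gt_1 less_trans in blast)
qed

lemma one_less_pi_squared_div_6: "1 < pi\<^sup>2 / 6"
proof -
  have "(\<Sum>n<2. 1 / (1 + real n)\<^sup>2) \<le> pi\<^sup>2 / 6"
    using sum_le_suminf[OF sums_summable[OF inverse_squares_sums], of "{..<2}"]
      sums_unique[OF inverse_squares_sums] by simp
  then show ?thesis
    by (simp add: numeral_2_eq_2)
qed

definition well_numerator :: "real \<Rightarrow> real \<Rightarrow> real" where
  "well_numerator \<delta> x = 2 * ln (pi\<^sup>2 / 6 / \<delta>) + 4 * ln (1 + log 2 x)"

lemma well_numerator_pos:
  assumes "0 < \<delta>" "\<delta> \<le> 1" "1 \<le> x"
  shows "0 < well_numerator \<delta> x"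
proof -
  have "1 < pi\<^sup>2 / 6 / \<delta>"
    using one_less_pi_squared_div_6 assms(1,2) by (simp only: less_divide_eq_1_pos)
  moreover have "0 \<le> log 2 x"
    using assms(3) by simp
  ultimately show ?thesis
    unfolding well_numerator_def by (intro add_pos_nonneg) auto
qed

lemma well_numerator_mono:
  assumes "1 \<le> x" "x \<le> y"
  shows "well_numerator \<delta> x \<le> well_numerator \<delta> y"
proof -
  have "0 \<le> log 2 x" "log 2 x \<le> log 2 y"
    using assms by simp_all
  then show ?thesis
    unfolding well_numerator_def by simp
qed

lemma well_fdp_bound_le:
  assumes \<delta>: "0 < \<delta>" "\<delta> \<le> 1" and \<alpha>: "0 < \<alpha>" "\<alpha> \<le> 1" and "0 < c" "0 < m"
    and le: "real m * c \<le> real (bh_count \<alpha> m p)"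
  shows "well_fdp_bound \<alpha> \<delta> m p \<le> \<alpha> * h_inv (well_numerator \<delta> (1 / (\<alpha> * c)) / (\<alpha> * (real m * c)))"
proof -
  define k where "k = bh_count \<alpha> m p"
  define x where "x = real m / (\<alpha> * real k)"
  have rejections: "0 < real m * c" "real m * c \<le> real k"
    using assms by (simp_all add: k_def)
  then have k_bounds: "0 < real k" "k \<le> m" "max 1 k = k"
    using bh_count_le[of \<alpha> m p] by (simp_all add: k_def max_def)
  have "\<alpha> * real k \<le> 1 * real m"
    using \<alpha> k_bounds by (intro mult_mono) auto
  then have "1 \<le> x"
    using \<alpha> k_bounds by (simp add: x_def)
  moreover have "x \<le> real m / (\<alpha> * (real m * c))"
    unfolding x_def using \<alpha> \<open>0 < c\<close> rejections k_bounds by (intro divide_left_mono mult_left_mono mult_pos_pos) auto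
  then have "x \<le> 1 / (\<alpha> * c)"
    using \<open>0 < m\<close> by simp
  ultimately have numerator: "0 < well_numerator \<delta> x"
    "well_numerator \<delta> x \<le> well_numerator \<delta> (1 / (\<alpha> * c))"
    using \<delta> by (simp_all add: well_numerator_pos well_numerator_mono)
  have "well_fdp_bound \<alpha> \<delta> m p \<le> \<alpha> * h_inv (well_numerator \<delta> x / (\<alpha> * real k))"
    unfolding well_fdp_bound_def Let_def k_def[symmetric] x_def well_numerator_def k_bounds(3)
    by (rule min.cobounded2)
  also have "\<dots> \<le> \<alpha> * h_inv (well_numerator \<delta> (1 / (\<alpha> * c)) / (\<alpha> * (real m * c)))"
    using \<alpha> \<open>0 < c\<close> numerator rejections k_bounds
    by (intro mult_left_mono h_inv_mono frac_le divide_pos_pos mult_pos_pos) auto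
  finally show ?thesis .
qed

section \<open>The two-group model\<close>

lemma indep_vars_PiM_components:
  assumes "\<And>i. i \<in> I \<Longrightarrow> prob_space (M i)"
  shows "prob_space.indep_vars (PiM I M) M (\<lambda>i \<omega>. \<omega> i) I"
proof -
  interpret prob_space "PiM I M"
    using assms by (rule prob_space_PiM)
  show ?thesis
  proof (cases "I = {}")
    case True
    then show ?thesis
      unfolding indep_vars_def indep_sets_def by simp
  next
    case False
    have "distr (PiM I M) (PiM I M) (\<lambda>\<omega>. \<lambda>i\<in>I. \<omega> i) = distr (PiM I M) (PiM I M) (\<lambda>\<omega>. \<omega>)"
      by (intro distr_cong) (auto simp: space_PiM PiE_def extensional_restrict)
    also have "\<dots> = PiM I (\<lambda>i. distr (PiM I M) (M i) (\<lambda>\<omega>. \<omega> i))"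
      using assms by (auto simp: distr_id intro!: PiM_cong distr_PiM_component[symmetric])
    finally show ?thesis
      using False by (subst indep_vars_iff_distr_eq_PiM') auto
  qed
qed

definition two_group_cdf :: "real \<Rightarrow> real measure \<Rightarrow> real \<Rightarrow> real" where
  "two_group_cdf \<pi>\<^sub>0 G t = \<pi>\<^sub>0 * t + (1 - \<pi>\<^sub>0) * cdf G t"

definition bh_rejects_fraction :: "real \<Rightarrow> real measure \<Rightarrow> real \<Rightarrow> real \<Rightarrow> bool" where
  "bh_rejects_fraction \<pi>\<^sub>0 G \<alpha> c \<longleftrightarrow>
     (\<lambda>m. \<P>(\<omega> in two_group_model \<pi>\<^sub>0 G m. real (bh_count \<alpha> m (pvals \<omega>)) \<le> real m * c)) \<longlonglongrightarrow> 0"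

locale two_group =
  fixes \<pi>\<^sub>0 :: real and G :: "real measure"
  assumes null_fraction: "\<pi>\<^sub>0 \<in> {0<..<1}"
    and alternative: "real_distribution G"
begin

lemma sets_two_group_coord [measurable_cong]:
  "sets (two_group_coord \<pi>\<^sub>0 G) = sets (count_space UNIV \<Otimes>\<^sub>M borel)"
  unfolding two_group_coord_def by (rule sets_bind) auto

lemma prob_space_two_group_coord: "prob_space (two_group_coord \<pi>\<^sub>0 G)"
proof -
  interpret G: real_distribution G
    by (rule alternative)
  let ?U = "uniform_measure lborel {0..1::real}"
  let ?K = "count_space (UNIV :: bool set) \<Otimes>\<^sub>M (borel :: real measure)"
  let ?N = "\<lambda>H::bool. distr (if H then ?U else G) ?K (\<lambda>x. (H, x))"
  have prob: "prob_space (?N H)" for H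
  proof (rule prob_space.prob_space_distr)
    show "prob_space (if H then ?U else G)"
      using G.prob_space_axioms by (auto intro!: prob_space_uniform_measure)
    show "(\<lambda>x. (H, x)) \<in> measurable (if H then ?U else G) ?K"
      by (cases H) simp_all
  qed
  then have "?N \<in> measurable (measure_pmf (bernoulli_pmf \<pi>\<^sub>0)) (subprob_algebra ?K)"
    by (auto simp: space_subprob_algebra simp del: if_split intro!: prob_space_imp_subprob_space)
  then show ?thesis
    unfolding two_group_coord_def
    by (rule measure_pmf.prob_space_bind[rotated]) (rule AE_I2, rule prob)
qed

lemma indep_pvalues_two_group_model: "indep_pvalues (two_group_model \<pi>\<^sub>0 G m) pvals m"
proof -
  interpret model: prob_space "two_group_model \<pi>\<^sub>0 G m"
    unfolding two_group_model_def by (intro prob_space_PiM prob_space_two_group_coord)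
  have "model.indep_vars (\<lambda>_. two_group_coord \<pi>\<^sub>0 G) (\<lambda>i \<omega>. \<omega> i) {1..m}"
    unfolding two_group_model_def by (intro indep_vars_PiM_components prob_space_two_group_coord)
  then have "model.indep_vars (\<lambda>_. borel) (\<lambda>i \<omega>. pvals \<omega> i) {1..m}"
    unfolding pvals_def by (rule model.indep_vars_compose2) measurable
  then show ?thesis
    by unfold_locales
qed

lemma prob_pvals_le:
  assumes "i \<in> {1..m}" "t \<in> {0..1}"
  shows "\<P>(\<omega> in two_group_model \<pi>\<^sub>0 G m. pvals \<omega> i \<le> t) = two_group_cdf \<pi>\<^sub>0 G t"
proof -
  let ?C = "two_group_coord \<pi>\<^sub>0 G"
  have "two_group_cdf \<pi>\<^sub>0 G t = cdf (distr ?C borel snd) t"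
    using cdf_two_group_coord[OF alternative null_fraction assms(2)]
    by (simp add: two_group_cdf_def)
  also have "?C = distr (two_group_model \<pi>\<^sub>0 G m) ?C (\<lambda>\<omega>. \<omega> i)"
    unfolding two_group_model_def using assms(1)
    by (intro distr_PiM_component[symmetric] prob_space_two_group_coord)
  also have "distr \<dots> borel snd = distr (two_group_model \<pi>\<^sub>0 G m) borel (\<lambda>\<omega>. pvals \<omega> i)"
    unfolding two_group_model_def pvals_def using assms(1)
    by (subst distr_distr) (simp_all add: comp_def)
  also have "cdf \<dots> t = \<P>(\<omega> in two_group_model \<pi>\<^sub>0 G m. pvals \<omega> i \<le> t)"
    using indep_pvalues.measurable_pvalue[OF indep_pvalues_two_group_model assms(1)]
    by (auto simp: cdf_def measure_distr intro!: arg_cong[where f = "measure _"])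
  finally show ?thesis
    by simp
qed

section \<open>Consistency\<close>

lemma bh_rejects_fractionI:
  assumes "0 < \<alpha>" "t \<in> {0..1}" "t / \<alpha> < two_group_cdf \<pi>\<^sub>0 G t"
  shows "bh_rejects_fraction \<pi>\<^sub>0 G \<alpha> (t / \<alpha>)"
  unfolding bh_rejects_fraction_def
proof (rule tendsto_sandwich[OF _ _ tendsto_const])
  define \<eta> where "\<eta> = two_group_cdf \<pi>\<^sub>0 G t - t / \<alpha>"
  show "\<forall>\<^sub>F m in sequentially.
      \<P>(\<omega> in two_group_model \<pi>\<^sub>0 G m. real (bh_count \<alpha> m (pvals \<omega>)) \<le> real m * (t / \<alpha>))
        \<le> exp (- 2 * \<eta>\<^sup>2 * real m)"
    unfolding \<eta>_def using assms prob_pvals_le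
    by (intro always_eventually allI indep_pvalues.prob_bh_count_le[OF indep_pvalues_two_group_model]) auto
  have "\<eta> > 0"
    using assms(3) by (simp add: \<eta>_def)
  then show "(\<lambda>m. exp (- 2 * \<eta>\<^sup>2 * real m)) \<longlonglongrightarrow> 0"
    by real_asymp
qed simp

lemma bh_m_consistentI:
  assumes fraction: "bh_rejects_fraction \<pi>\<^sub>0 G \<alpha> c"
    and B: "\<And>m p. 0 < m \<Longrightarrow> real m * c \<le> real (bh_count \<alpha> m p) \<Longrightarrow> B m p \<le> b m"
    and b: "b \<longlonglongrightarrow> \<alpha>"
  shows "bh_m_consistent \<pi>\<^sub>0 G \<alpha> B"
  unfolding bh_m_consistent_def
proof (intro allI impI)
  fix \<epsilon> :: real assume "0 < \<epsilon>"
  show "(\<lambda>m. \<P>(\<omega> in two_group_model \<pi>\<^sub>0 G m. B m (pvals \<omega>) - \<alpha> \<ge> \<epsilon>)) \<longlonglongrightarrow> 0"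
  proof (rule tendsto_sandwich[OF _ _ tendsto_const fraction[unfolded bh_rejects_fraction_def]])
    have "\<forall>\<^sub>F m in sequentially. b m < \<alpha> + \<epsilon>"
      using b \<open>0 < \<epsilon>\<close> by (intro order_tendstoD) auto
    then show "\<forall>\<^sub>F m in sequentially.
        \<P>(\<omega> in two_group_model \<pi>\<^sub>0 G m. B m (pvals \<omega>) - \<alpha> \<ge> \<epsilon>) \<le>
        \<P>(\<omega> in two_group_model \<pi>\<^sub>0 G m. real (bh_count \<alpha> m (pvals \<omega>)) \<le> real m * c)"
      using eventually_gt_at_top[of 0]
    proof eventually_elim
      case (elim m)
      interpret indep_pvalues "two_group_model \<pi>\<^sub>0 G m" pvals m
        by (rule indep_pvalues_two_group_model)
      have "real (bh_count \<alpha> m p) \<le> real m * c" if "B m p - \<alpha> \<ge> \<epsilon>" for p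
        using B[OF elim(2), of p] elim(1) that by linarith
      then show ?case
        by (intro finite_measure_mono) auto
    qed
  qed simp
qed

lemma bh_m_consistent_dkw_fdp_bound:
  assumes "0 < \<delta>" "\<delta> \<le> 1" "0 < c" and fraction: "bh_rejects_fraction \<pi>\<^sub>0 G \<alpha> c"
  shows "bh_m_consistent \<pi>\<^sub>0 G \<alpha> (dkw_fdp_bound \<alpha> \<delta>)"
proof (rule bh_m_consistentI[OF fraction])
  show "dkw_fdp_bound \<alpha> \<delta> m p \<le> \<alpha> + sqrt (0.5 * ln (1 / \<delta>)) / (sqrt (real m) * c)"
    if "0 < m" "real m * c \<le> real (bh_count \<alpha> m p)" for m p
    using assms that by (intro dkw_fdp_bound_le)
  show "(\<lambda>m. \<alpha> + sqrt (0.5 * ln (1 / \<delta>)) / (sqrt (real m) * c)) \<longlonglongrightarrow> \<alpha>"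
    using assms(3) by real_asymp
qed

lemma bh_m_consistent_well_fdp_bound:
  assumes "0 < \<delta>" "\<delta> \<le> 1" "0 < \<alpha>" "\<alpha> \<le> 1" "0 < c" "\<alpha> * c \<le> 1"
    and fraction: "bh_rejects_fraction \<pi>\<^sub>0 G \<alpha> c"
  shows "bh_m_consistent \<pi>\<^sub>0 G \<alpha> (well_fdp_bound \<alpha> \<delta>)"
proof (rule bh_m_consistentI[OF fraction])
  let ?A = "well_numerator \<delta> (1 / (\<alpha> * c))"
  let ?y = "\<lambda>m. ?A / (\<alpha> * (real m * c))"
  show "well_fdp_bound \<alpha> \<delta> m p \<le> \<alpha> * h_inv (?y m)"
    if "0 < m" "real m * c \<le> real (bh_count \<alpha> m p)" for m p
    using assms that by (intro well_fdp_bound_le)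
  have "0 < ?A"
    using assms by (intro well_numerator_pos) simp_all
  then have "\<forall>\<^sub>F m in sequentially. 0 < ?y m"
    using assms(3,5) by (intro eventually_mono[OF eventually_gt_at_top[of 0]]) simp
  moreover have "?y \<longlonglongrightarrow> 0"
    using assms(3,5) by real_asymp
  ultimately have "filterlim ?y (at_right 0) sequentially"
    by (intro tendsto_imp_filterlim_at_right)
  then have "(\<lambda>m. \<alpha> * h_inv (?y m)) \<longlonglongrightarrow> \<alpha> * 1"
    by (intro tendsto_intros filterlim_compose[OF tendsto_h_inv_at_right_0])
  then show "(\<lambda>m. \<alpha> * h_inv (?y m)) \<longlonglongrightarrow> \<alpha>"
    by simp
qed

lemma not_bh_m_consistent_simes_fdp_bound:
  assumes \<alpha>: "0 \<le> \<alpha>" "\<alpha> < 1" and \<delta>: "0 \<le> \<delta>" "\<delta> \<le> 1" and a: "0 \<le> a" "a * \<delta> < 1"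
    and F: "\<And>t. t \<in> {0..\<delta>} \<Longrightarrow> two_group_cdf \<pi>\<^sub>0 G t \<le> a * t"
    and "0 \<le> c" and fraction: "bh_rejects_fraction \<pi>\<^sub>0 G \<alpha> c"
  shows "\<not> bh_m_consistent \<pi>\<^sub>0 G \<alpha> (simes_fdp_bound \<alpha> \<delta>)"
proof
  let ?M = "two_group_model \<pi>\<^sub>0 G"
  let ?B = "\<lambda>m. \<P>(\<omega> in ?M m. simes_fdp_bound \<alpha> \<delta> m (pvals \<omega>) \<ge> 1)"
  let ?K = "\<lambda>m. \<P>(\<omega> in ?M m. real (bh_count \<alpha> m (pvals \<omega>)) \<le> real m * c)"
  assume "bh_m_consistent \<pi>\<^sub>0 G \<alpha> (simes_fdp_bound \<alpha> \<delta>)"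
  moreover have "0 < 1 - \<alpha>"
    using \<alpha>(2) by simp
  ultimately have "(\<lambda>m. \<P>(\<omega> in ?M m. simes_fdp_bound \<alpha> \<delta> m (pvals \<omega>) - \<alpha> \<ge> 1 - \<alpha>)) \<longlonglongrightarrow> 0"
    unfolding bh_m_consistent_def by blast
  then have "?B \<longlonglongrightarrow> 0"
    by simp
  with fraction have "(\<lambda>m. ?B m + ?K m) \<longlonglongrightarrow> 0 + 0"
    unfolding bh_rejects_fraction_def by (intro tendsto_add)
  moreover have "1 - a * \<delta> \<le> ?B m + ?K m" for m
  proof -
    interpret indep_pvalues "?M m" pvals m
      by (rule indep_pvalues_two_group_model)
    have "\<P>(\<omega> in ?M m. 1 \<le> bh_count \<delta> m (pvals \<omega>)) \<le> a * \<delta>"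
      using \<delta> a F by (intro simes_inequality) (auto simp: prob_pvals_le)
    moreover have "\<P>(\<omega> in ?M m. bh_count \<alpha> m (pvals \<omega>) = 0) \<le> ?K m"
      using \<open>0 \<le> c\<close> by (intro finite_measure_mono) auto
    ultimately show ?thesis
      using prob_one_le_simes_fdp_bound_ge[OF \<alpha>(1), of \<delta>] by linarith
  qed
  ultimately have "1 - a * \<delta> \<le> 0 + 0"
    by (intro LIMSEQ_le_const) auto
  with a(2) show False
    by simp
qed

end

section \<open>The alternative density\<close>

context
  fixes g :: "real \<Rightarrow> real" and G :: "real measure"
  assumes G: "G = density lborel (\<lambda>x. ennreal (g x) * indicator {0..1} x)"
    and nonneg: "\<forall>x\<in>{0..1}. g x \<ge> 0"
    and cont: "continuous_on {0..1} g"
begin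

lemma cdf_density_eq_integral:
  assumes t: "t \<in> {0..1}"
  shows "cdf G t = integral {0..t} g"
proof -
  have integral: "(g has_integral integral {0..t} g) {0..t}"
    using t by (intro integrable_integral integrable_continuous_interval continuous_on_subset[OF cont]) auto
  have "(\<lambda>x. ennreal (indicator {0..1} x *\<^sub>R g x)) \<in> borel_measurable lborel"
    using borel_measurable_continuous_on_indicator[OF _ cont] by simp
  also have "(\<lambda>x. ennreal (indicator {0..1} x *\<^sub>R g x)) = (\<lambda>x. ennreal (g x) * indicator {0..1} x)"
    by (auto simp: indicator_def)
  finally have "emeasure G {..t} = (\<integral>\<^sup>+ x. ennreal (g x) * indicator {0..1} x * indicator {..t} x \<partial>lborel)"
    unfolding G by (intro emeasure_density) auto
  also have "\<dots> = (\<integral>\<^sup>+ x. ennreal (g x) * indicator {0..t} x \<partial>lborel)"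
    using t by (intro nn_integral_cong) (auto simp: indicator_def)
  also have "\<dots> = ennreal (integral {0..t} g)"
    using nonneg t by (intro nn_integral_has_integral_lebesgue' integral) auto
  finally show ?thesis
    unfolding cdf_def using nonneg t
    by (intro measure_eq_emeasure_eq_ennreal has_integral_nonneg[OF integral]) auto
qed

lemma two_group_cdf_le_linear:
  assumes "\<pi>\<^sub>0 \<le> 1" "antimono_on {0..1} g" "t \<in> {0..1}"
  shows "two_group_cdf \<pi>\<^sub>0 G t \<le> (\<pi>\<^sub>0 + (1 - \<pi>\<^sub>0) * g 0) * t"
proof -
  have "integral {0..t} g \<le> integral {0..t} (\<lambda>_. g 0)"
    using assms(3) monotone_onD[OF assms(2), of 0]
    by (intro integral_le integrable_continuous_interval continuous_on_subset[OF cont]) auto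
  then have "cdf G t \<le> g 0 * t"
    using assms(3) by (simp add: cdf_density_eq_integral mult.commute)
  then have "(1 - \<pi>\<^sub>0) * cdf G t \<le> (1 - \<pi>\<^sub>0) * (g 0 * t)"
    using assms(1) by (intro mult_left_mono) auto
  then show ?thesis
    by (simp add: two_group_cdf_def algebra_simps)
qed

lemma two_group_cdf_has_derivative_0:
  "(two_group_cdf \<pi>\<^sub>0 G has_real_derivative \<pi>\<^sub>0 + (1 - \<pi>\<^sub>0) * g 0) (at 0 within {0..1})"
proof (rule has_field_derivative_transform_within[OF _ zero_less_one])
  have "((\<lambda>t. integral {0..t} g) has_real_derivative g 0) (at 0 within {0..1})"
    by (rule integral_has_real_derivative[OF cont]) simp
  then show "((\<lambda>t. \<pi>\<^sub>0 * t + (1 - \<pi>\<^sub>0) * integral {0..t} g) has_real_derivative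
      \<pi>\<^sub>0 + (1 - \<pi>\<^sub>0) * g 0) (at 0 within {0..1})"
    by (auto intro!: derivative_eq_intros)
qed (simp_all add: two_group_cdf_def cdf_density_eq_integral)

lemma ex_linear_less_two_group_cdf:
  assumes "b < \<pi>\<^sub>0 + (1 - \<pi>\<^sub>0) * g 0"
  shows "\<exists>t\<in>{0<..1}. b * t < two_group_cdf \<pi>\<^sub>0 G t"
proof -
  have "two_group_cdf \<pi>\<^sub>0 G 0 = 0"
    by (simp add: two_group_cdf_def cdf_density_eq_integral)
  then have "((\<lambda>t. two_group_cdf \<pi>\<^sub>0 G t / t) \<longlongrightarrow> \<pi>\<^sub>0 + (1 - \<pi>\<^sub>0) * g 0) (at_right 0)"
    using two_group_cdf_has_derivative_0[of \<pi>\<^sub>0]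
    by (simp add: has_field_derivative_iff at_within_Icc_at_right)
  then have "\<forall>\<^sub>F t in at_right 0. b < two_group_cdf \<pi>\<^sub>0 G t / t"
    using assms by (rule order_tendstoD)
  moreover have "\<forall>\<^sub>F t in at_right 0. t \<in> {0<..<1::real}"
    by (rule eventually_at_right_real) simp
  ultimately have "\<forall>\<^sub>F t in at_right 0. t \<in> {0<..1} \<and> b * t < two_group_cdf \<pi>\<^sub>0 G t"
    by eventually_elim (simp add: less_divide_eq)
  then show ?thesis
    using eventually_happens'[OF trivial_limit_at_right_real] by blast
qed

end

theorem proposition17:
  fixes \<pi>\<^sub>0 \<alpha> \<delta> :: real and g :: "real \<Rightarrow> real" and G :: "real measure"
  assumes "0 < \<pi>\<^sub>0" and "\<pi>\<^sub>0 < 1"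
    and "prob_space G"
    and "G = density lborel (\<lambda>x. ennreal (g x) * indicator {0..1} x)"
    and "\<forall>x\<in>{0..1}. g x \<ge> 0"
    and "continuous_on {0..1} g"
    and "antimono_on {0..1} g"
    and "0 < \<delta>"
    and "\<delta> < 1 / (\<pi>\<^sub>0 + (1 - \<pi>\<^sub>0) * g 0)"
    and "1 / (\<pi>\<^sub>0 + (1 - \<pi>\<^sub>0) * g 0) < \<alpha>"
    and "\<alpha> < 1"
  shows "\<not> bh_m_consistent \<pi>\<^sub>0 G \<alpha> (simes_fdp_bound \<alpha> \<delta>)
       \<and> bh_m_consistent \<pi>\<^sub>0 G \<alpha> (dkw_fdp_bound \<alpha> \<delta>)
       \<and> bh_m_consistent \<pi>\<^sub>0 G \<alpha> (well_fdp_bound \<alpha> \<delta>)"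
proof -
  interpret two_group \<pi>\<^sub>0 G
    using assms(1-4) by (simp add: two_group_def real_distribution_def real_distribution_axioms_def)
  define a where "a = \<pi>\<^sub>0 + (1 - \<pi>\<^sub>0) * g 0"
  have "0 < a"
    unfolding a_def using assms(1,2,5) by (intro add_pos_nonneg) auto
  have \<delta>: "\<delta> < 1 / a" and \<alpha>: "1 / a < \<alpha>"
    using assms(9,10) by (simp_all only: a_def)
  have "0 < \<alpha>" "\<delta> \<le> 1"
    using \<open>0 < a\<close> \<delta> \<alpha> assms(11) less_trans[of 0 "1 / a" \<alpha>] by simp_all
  then have "a * \<delta> < 1" "1 / \<alpha> < a"
    using \<open>0 < a\<close> \<delta> \<alpha> by (simp_all add: field_simps)
  obtain t where t: "t \<in> {0<..1}" "1 / \<alpha> * t < two_group_cdf \<pi>\<^sub>0 G t"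
    using ex_linear_less_two_group_cdf[OF assms(4-6)] \<open>1 / \<alpha> < a\<close> unfolding a_def by blast
  then have "bh_rejects_fraction \<pi>\<^sub>0 G \<alpha> (t / \<alpha>)"
    using \<open>0 < \<alpha>\<close> by (intro bh_rejects_fractionI) auto
  moreover have "two_group_cdf \<pi>\<^sub>0 G s \<le> a * s" if "s \<in> {0..\<delta>}" for s
    unfolding a_def using assms(2,7) \<open>\<delta> \<le> 1\<close> that by (intro two_group_cdf_le_linear[OF assms(4-6)]) auto
  ultimately show ?thesis
    using t \<open>0 < a\<close> \<open>0 < \<alpha>\<close> \<open>\<delta> \<le> 1\<close> \<open>a * \<delta> < 1\<close> assms(8,11)
    by (intro conjI not_bh_m_consistent_simes_fdp_bound[of \<alpha> \<delta> a "t / \<alpha>"]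
        bh_m_consistent_dkw_fdp_bound[of \<delta> "t / \<alpha>"] bh_m_consistent_well_fdp_bound[of \<delta> \<alpha> "t / \<alpha>"]) auto
qed

end
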